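(* Let $p$ be a prime, $q$ an odd prime and $c$ a positive integer. Then \[ v_p(\sigma(q^c))\leq v_p(c+1)+\left\lfloor 283(p-1)\frac{\log 2}{\log p}\cdot\frac{\log (2q)}{\log p}\right\rfloor+4. \] Moreover, for every positive integer $c$, \[ v_p(\sigma(2^c))\leq v_p(c+1)+\left\lfloor 283(p-1)\frac{\log 3}{\log p}\cdot\frac{\log 6}{\log p}\right\rfloor+4. \] Furthermore, assume the following hypothesis (H): (i) the inequality $v_p(x^{p-1}-1)\leq 2+\frac{\log x+2\log\log x+\log\log p}{\log p}$ holds for all integers $x>1$ and primes $p$ except for finitely many pairs $(x,p)$; and (ii) the inequality $v_p(q^{p-1}-1)\leq 2+\frac{\log q+\log\log q+\log\log p}{\log p}$ holds for all pairs of primes $(q,p)$ except for finitely many pairs. Then, except for finitely many pairs $(p,q)$ of a prime $p$ and an odd prime $q$, for every positive integer $c$, \[ v_p(\sigma(q^c))\leq v_p(c+1)+2+\frac{\log q+\log\log q+\log\log p}{\log p}. \]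
   Context: $\sigma(n)$ is the sum of the positive divisors of $n$. $v_p(n)$ denotes the exponent of the prime $p$ in the nonzero integer $n$, $\lfloor\cdot\rfloor$ is the floor function, and $\log$ is the natural logarithm. *)

theory Defs
  imports Complex_Main "HOL-Computational_Algebra.Primes"
begin

definition sigma :: "nat \<Rightarrow> nat" where
  "sigma n = (\<Sum>d | d dvd n. d)"

(* The powers are taken in int so that the subtraction is the true one. *)
definition hypothesis_H :: bool where
  "hypothesis_H \<longleftrightarrow>
     finite {(x :: int, p :: nat). x > 1 \<and> prime p \<and>
       \<not> real (multiplicity (int p) (x ^ (p - 1) - 1))
           \<le> 2 + (ln (real_of_int x) + 2 * ln (ln (real_of_int x)) + ln (ln (real p))) / ln (real p)} \<and>
     finite {(q :: nat, p :: nat). prime q \<and> prime p \<and>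
       \<not> real (multiplicity (int p) (int q ^ (p - 1) - 1))
           \<le> 2 + (ln (real q) + ln (ln (real q)) + ln (ln (real p))) / ln (real p)}"

end

theory Submission
  imports Defs "HOL-Number_Theory.Number_Theory" "HOL-Computational_Algebra.Polynomial"
begin

text \<open>
  Write \<open>d\<close> for the order of \<open>q\<close> modulo an odd prime \<open>p\<close>. Lifting the exponent reduces everything
  to bounding \<open>v = v\<^sub>p(q\<^sup>d - 1)\<close>, and the conditional part is then immediate from (H)(ii).

  For the unconditional bound take \<open>r = 2\<close> (or \<open>r = 3\<close> if \<open>q = 2\<close>). Since \<open>q\<close> is a root of unity
  modulo \<open>p\<^sup>v\<close>, the numbers \<open>r\<^sup>a q\<^sup>b\<close> lying in a fixed class modulo \<open>p\<close> satisfy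
  \<open>r\<^sup>a q\<^sup>b \<equiv> C \<eta>\<^sup>a\<close> modulo \<open>p\<^sup>v\<close> with \<open>\<eta> \<equiv> 1\<close> modulo \<open>p\<close>, and \<open>\<eta>\<^sup>a\<close> is modulo \<open>p\<^sup>v\<close> a polynomial
  of degree less than \<open>v\<close> in \<open>a\<close>. The box principle therefore gives small integer-valued polynomials
  \<open>A, B\<close>, not both zero, with \<open>A(a) + B(a) r\<^sup>a q\<^sup>b\<close> divisible by \<open>p\<^sup>v\<close> on the class, hence zero when \<open>(a, b)\<close>
  stays in a box of moderate size. A box with at least \<open>3 v (p - 1)\<close> points contains \<open>3 v\<close> points of
  one class; comparing the translates of these by two points of the class shows that
  \<open>\<gamma>\<^sub>2 A(x + a\<^sub>1) B(x + a\<^sub>2) = \<gamma>\<^sub>1 A(x + a\<^sub>2) B(x + a\<^sub>1)\<close> identically, and leading coefficients give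
  \<open>\<gamma>\<^sub>1 = \<gamma>\<^sub>2\<close>, contradicting the multiplicative independence of \<open>r\<close> and \<open>q\<close>.
\<close>

subsection \<open>Lifting the exponent\<close>

lemma geometric_sum_add:
  fixes x :: nat
  shows "(\<Sum>i<n + k. x ^ i) = (\<Sum>i<n. x ^ i) + x ^ n * (\<Sum>i<k. x ^ i)"
  by (induction k) (auto simp: algebra_simps power_add)

lemma geometric_sum_mult:
  fixes x :: nat
  shows "(\<Sum>i<k * m. x ^ i) = (\<Sum>i<k. x ^ i) * (\<Sum>j<m. (x ^ k) ^ j)"
proof (induction m)
  case (Suc m)
  have "(\<Sum>i<k * Suc m. x ^ i) = (\<Sum>i<k * m. x ^ i) + x ^ (k * m) * (\<Sum>i<k. x ^ i)"
    using geometric_sum_add[of x "k * m" k] by (simp add: add.commute)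
  thus ?case using Suc by (simp add: algebra_simps power_mult)
qed auto

text \<open>In the binomial expansion every term of index \<open>w\<close> or more carries a factor
  \<open>P ^ w\<close>. The number of terms kept does not depend on \<open>a\<close>, so modulo
  \<open>P ^ w\<close> the power is a polynomial in \<open>a\<close> of degree below
  \<open>w\<close>.\<close>

lemma one_plus_mult_power_cong:
  fixes u P :: int
  shows "[(1 + P * u) ^ a = (\<Sum>j<w. of_nat (a choose j) * (P * u) ^ j)] (mod P ^ w)"
proof -
  have "(1 + P * u) ^ a = (\<Sum>j\<le>a. of_nat (a choose j) * (P * u) ^ j)"
    using binomial_ring[of "P * u" 1 a] by (simp add: add.commute)
  \<comment> \<open>The padded range contains both \<open>{..a}\<close> and \<open>{..<w}\<close>;
    the added binomials vanish, so \<open>a < w\<close> needs no separate case.\<close>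
  also have "\<dots> = (\<Sum>j<w + Suc a. of_nat (a choose j) * (P * u) ^ j)"
    by (rule sum.mono_neutral_left) (auto simp: binomial_eq_0)
  also have "\<dots> = (\<Sum>j<w. of_nat (a choose j) * (P * u) ^ j)
      + (\<Sum>j\<in>{w..<w + Suc a}. of_nat (a choose j) * (P * u) ^ j)"
    by (subst sum.union_disjoint[symmetric]) (auto intro!: sum.cong simp del: sum.lessThan_Suc add_Suc_right)
  also have "[\<dots> = (\<Sum>j<w. of_nat (a choose j) * (P * u) ^ j) + 0] (mod P ^ w)"
  proof (intro cong_add cong_refl)
    have "P ^ w dvd (\<Sum>j\<in>{w..<w + Suc a}. of_nat (a choose j) * (P * u) ^ j)"
      by (intro dvd_sum dvd_mult) (auto simp: power_mult_distrib intro!: dvd_mult2 le_imp_power_dvd)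
    thus "[(\<Sum>j\<in>{w..<w + Suc a}. of_nat (a choose j) * (P * u) ^ j) = 0] (mod P ^ w)"
      by (simp add: cong_0_iff)
  qed
  finally show ?thesis by simp
qed

text \<open>Splitting a factor \<open>p\<close> off \<open>m\<close> splits off a geometric sum of
  \<open>p\<close> terms in some power of \<open>x\<close>, which holds at most one factor
  \<open>p\<close>. Once \<open>p\<close> no longer divides \<open>m\<close>, the sum is congruent
  to \<open>m\<close> and so prime to \<open>p\<close>.\<close>

lemma multiplicity_geometric_sum_le:
  fixes p x m :: nat
  assumes "prime p" "[x = 1] (mod p)" "\<And>k. \<not> p\<^sup>2 dvd (\<Sum>j<p. (x ^ k) ^ j)" "m > 0"
  shows "multiplicity p (\<Sum>i<m. x ^ i) \<le> multiplicity p m"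
  using assms(4)
proof (induction m rule: less_induct)
  case (less m)
  have p: "prime_elem p" "p > 1" using assms(1) prime_gt_1_nat by auto
  have pos: "(\<Sum>i<n. y ^ i) > 0" if "n > 0" for n y :: nat
    using that by (cases n) (auto simp: sum.lessThan_Suc_shift simp del: sum.lessThan_Suc)
  show ?case
  proof (cases "p dvd m")
    case False
    have "[(\<Sum>i<m. x ^ i) = (\<Sum>i<m. 1 ^ i)] (mod p)"
      by (intro cong_sum cong_pow assms)
    hence "\<not> p dvd (\<Sum>i<m. x ^ i)" using False by (simp add: cong_dvd_iff)
    thus ?thesis by (simp add: not_dvd_imp_multiplicity_0)
  next
    case True
    then obtain k where k: "m = k * p" by (metis dvdE mult.commute)
    with less.prems p have k0: "k > 0" "k < m" by auto
    have "\<not> 2 \<le> multiplicity p (\<Sum>j<p. (x ^ k) ^ j)"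
      using assms(3)[of k] multiplicity_dvd' by blast
    moreover have "multiplicity p (\<Sum>i<m. x ^ i)
        = multiplicity p (\<Sum>i<k. x ^ i) + multiplicity p (\<Sum>j<p. (x ^ k) ^ j)"
      unfolding k geometric_sum_mult
      using pos[OF k0(1), of x] pos[of p "x ^ k"] p
      by (intro prime_elem_multiplicity_mult_distrib) linarith+
    moreover have "multiplicity p m = multiplicity p k + 1"
      unfolding k using p k0 by (subst prime_elem_multiplicity_mult_distrib) auto
    ultimately show ?thesis using less.IH[OF k0(2,1)] by linarith
  qed
qed

text \<open>Expanding \<open>y ^ j\<close> to first order in \<open>y - 1\<close>, the linear terms
  add up to a multiple of \<open>p\<^sup>2\<close>, so the sum is \<open>p\<close> modulo
  \<open>p\<^sup>2\<close>.\<close>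

lemma odd_prime_square_not_dvd_geometric_sum:
  fixes p y :: nat
  assumes "prime p" "odd p" "[y = 1] (mod p)"
  shows "\<not> p\<^sup>2 dvd (\<Sum>j<p. y ^ j)"
proof
  assume dvd: "p\<^sup>2 dvd (\<Sum>j<p. y ^ j)"
  have "[int y = 1] (mod int p)" using assms(3) by (metis cong_int_iff of_nat_1)
  then obtain z where z: "int y = 1 + int p * z"
    by (metis cong_iff_lin cong_sym)
  have "[(\<Sum>j<p. int y ^ j) = (\<Sum>j<p. 1 + int j * (int p * z))] (mod int p ^ 2)"
  proof (rule cong_sum)
    fix j
    show "[int y ^ j = 1 + int j * (int p * z)] (mod int p ^ 2)"
      using one_plus_mult_power_cong[of "int p" z j 2] by (simp add: z numeral_2_eq_2)
  qed
  also have "(\<Sum>j<p. 1 + int j * (int p * z)) = int p + (\<Sum>j<p. int j) * (int p * z)"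
    by (simp add: sum.distrib sum_distrib_right)
  \<comment> \<open>Oddness enters here: \<open>(p - 1) div 2\<close> is an exact quotient, so the
    sum of the indices is a multiple of \<open>p\<close>.\<close>
  also have "(\<Sum>j<p. int j) = int p * (int (p - 1) div 2)"
  proof -
    obtain t where t: "p = Suc (2 * t)" using assms(2) by (auto elim: oddE)
    show ?thesis unfolding t by (induction t) (auto simp: algebra_simps)
  qed
  also have "[int p + int p * (int (p - 1) div 2) * (int p * z) = int p + 0] (mod int p ^ 2)"
    by (intro cong_add cong_refl) (simp add: cong_0_iff power2_eq_square)
  finally have "[(\<Sum>j<p. int y ^ j) = int p] (mod int p ^ 2)" by simp
  moreover have "int p ^ 2 dvd (\<Sum>j<p. int y ^ j)"
    using dvd by (metis (mono_tags, lifting) int_dvd_int_iff of_nat_power of_nat_sum sum.cong)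
  ultimately have "int p ^ 2 dvd int p" by (simp add: cong_dvd_iff)
  hence "p ^ 2 dvd p" by (metis int_dvd_int_iff of_nat_power)
  hence "p ^ 2 \<le> p" using assms(1) prime_gt_0_nat by (intro dvd_imp_le) auto
  thus False using prime_gt_1_nat[OF assms(1)] by (simp add: power2_eq_square)
qed

text \<open>If \<open>p\<close> divides the sum, the order \<open>d\<close> divides
  \<open>n = d * m\<close>. The sum then factors into one of \<open>d\<close> terms, which divides
  \<open>q ^ d - 1\<close>, and one of \<open>m\<close> terms in \<open>q ^ d\<close>, which is 1
  modulo \<open>p\<close> and contributes at most the multiplicity of \<open>m\<close>.\<close>

lemma multiplicity_geometric_sum_le_ord:
  fixes p q n :: nat
  assumes "prime p" "odd p" "\<not> p dvd q" "q > 1" "n > 0"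
  shows "multiplicity p (\<Sum>i<n. q ^ i) \<le> multiplicity p n + multiplicity p (q ^ ord p q - 1)"
proof (cases "p dvd (\<Sum>i<n. q ^ i)")
  case False
  thus ?thesis by (simp add: not_dvd_imp_multiplicity_0)
next
  case True
  have p: "prime_elem p" using assms(1) by auto
  define d where "d = ord p q"
  have "coprime p q" using assms(1,3) by (simp add: prime_imp_coprime_nat)
  hence d0: "d > 0" by (simp add: d_def)
  have geo: "q ^ k - 1 = (q - 1) * (\<Sum>i<k. q ^ i)" for k
  proof -
    have "int (q ^ k - 1) = int q ^ k - 1" using assms(4) by (simp add: of_nat_diff)
    also have "\<dots> = int ((q - 1) * (\<Sum>i<k. q ^ i))"
      using assms(4) power_diff_1_eq[of "int q" k] by (simp add: of_nat_diff)
    finally show ?thesis by linarith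
  qed
  have "p dvd q ^ n - 1" using True unfolding geo by (rule dvd_mult)
  hence "[q ^ n = 1] (mod p)" using assms(4) by (subst cong_altdef_nat) auto
  hence "d dvd n" unfolding d_def by (simp only: ord_divides)
  then obtain m where m: "n = d * m" by blast
  have m0: "m > 0" using m assms(5) by simp
  have "[q ^ d = 1] (mod p)" unfolding d_def by (rule ord)
  hence "multiplicity p (\<Sum>j<m. (q ^ d) ^ j) \<le> multiplicity p m"
    using assms(1,2) m0
    by (intro multiplicity_geometric_sum_le odd_prime_square_not_dvd_geometric_sum)
       (metis cong_pow power_one)+
  moreover have "multiplicity p (\<Sum>i<d. q ^ i) \<le> multiplicity p (q ^ d - 1)"
  proof (rule dvd_imp_multiplicity_le)
    show "(\<Sum>i<d. q ^ i) dvd q ^ d - 1" unfolding geo by (rule dvd_triv_right)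
    show "q ^ d - 1 \<noteq> 0" using one_less_power[OF assms(4) d0] by linarith
  qed
  moreover have "multiplicity p m \<le> multiplicity p n"
    using m assms(5) by (intro dvd_imp_multiplicity_le) auto
  moreover have "multiplicity p (\<Sum>i<n. q ^ i) = multiplicity p (\<Sum>i<d. q ^ i) + multiplicity p (\<Sum>j<m. (q ^ d) ^ j)"
    unfolding m geometric_sum_mult
  proof (rule prime_elem_multiplicity_mult_distrib[OF p])
    show "(\<Sum>i<d. q ^ i) \<noteq> 0"
    proof
      assume "(\<Sum>i<d. q ^ i) = 0"
      hence "q ^ d - 1 = 0" unfolding geo by (rule ssubst) simp
      thus False using one_less_power[OF assms(4) d0] by linarith
    qed
    show "(\<Sum>j<m. (q ^ d) ^ j) \<noteq> 0" using m0 by (cases m) (auto simp: sum.lessThan_Suc_shift simp del: sum.lessThan_Suc)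
  qed
  ultimately show ?thesis by (simp add: d_def)
qed

text \<open>Here \<open>q\<^sup>2\<close> replaces \<open>q ^ d\<close>: it is 1 modulo 4, so each
  two-term sum in its powers is 2 modulo 4. The subtracted 1 is the factor 2 already counted in
  \<open>n = 2 * m\<close>.\<close>

lemma multiplicity_2_geometric_sum_le:
  fixes q n :: nat
  assumes "odd q" "n > 0"
  shows "multiplicity 2 (\<Sum>i<n. q ^ i) \<le> multiplicity 2 n + (multiplicity 2 (q + 1) - 1)"
proof (cases "even n")
  case False
  have "odd (\<Sum>i<k. q ^ i) \<longleftrightarrow> odd k" for k using assms(1) by (induction k) auto
  hence "odd (\<Sum>i<n. q ^ i)" using False by blast
  thus ?thesis by (simp add: not_dvd_imp_multiplicity_0)
next
  case True
  then obtain m where m: "n = 2 * m" by auto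
  with assms have m0: "m > 0" by simp
  have q2: "[q\<^sup>2 = 1] (mod 4)"
  proof -
    obtain t where "q = 2 * t + 1" using assms(1) by (auto elim: oddE)
    hence "q\<^sup>2 = 4 * (t\<^sup>2 + t) + 1" by (simp add: power2_eq_square algebra_simps)
    thus ?thesis by (simp add: cong_def)
  qed
  have "multiplicity 2 (\<Sum>j<m. (q\<^sup>2) ^ j) \<le> multiplicity 2 m"
  proof (intro multiplicity_geometric_sum_le m0)
    show "[q\<^sup>2 = 1] (mod 2)" using q2 by (rule cong_dvd_modulus_nat) auto
    fix k
    have "[(q\<^sup>2) ^ k = 1 ^ k] (mod 4)" using q2 by (rule cong_pow)
    hence "[(\<Sum>j<2. ((q\<^sup>2) ^ k) ^ j) = 2] (mod 4)"
      using cong_add[of 1 1 4 "(q\<^sup>2) ^ k" 1] by (simp add: numeral_2_eq_2 cong_def)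
    thus "\<not> 2\<^sup>2 dvd (\<Sum>j<2. ((q\<^sup>2) ^ k) ^ j)"
      by (simp add: cong_dvd_iff)
  qed auto
  moreover have "multiplicity 2 (\<Sum>i<n. q ^ i) = multiplicity 2 (\<Sum>i<2. q ^ i) + multiplicity 2 (\<Sum>j<m. (q ^ 2) ^ j)"
    unfolding m geometric_sum_mult
  proof (rule prime_elem_multiplicity_mult_distrib)
    show "(\<Sum>i<2. q ^ i) \<noteq> 0" by (simp add: numeral_2_eq_2)
    show "(\<Sum>j<m. (q\<^sup>2) ^ j) \<noteq> 0" using m0 by (cases m) (auto simp: sum.lessThan_Suc_shift simp del: sum.lessThan_Suc)
  qed auto
  moreover have "(\<Sum>i<2. q ^ i) = q + 1" by (simp add: numeral_2_eq_2)
  moreover have "multiplicity 2 n = multiplicity 2 m + 1"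
    unfolding m using m0 by (subst prime_elem_multiplicity_mult_distrib) auto
  ultimately show ?thesis by simp
qed

section \<open>The divisor sum at prime powers\<close>

lemma sigma_prime_power:
  assumes "prime q"
  shows "sigma (q ^ c) = (\<Sum>i<c + 1. q ^ i)"
proof -
  have "{d. d dvd q ^ c} = (\<lambda>i. q ^ i) ` {..<c + 1}"
    using assms by (auto simp: divides_primepow_nat less_Suc_eq_le)
  moreover have "inj_on (\<lambda>i. q ^ i) {..<c + 1}"
    using prime_gt_1_nat[OF assms] by (auto simp: inj_on_def)
  ultimately show ?thesis by (simp add: sigma_def sum.reindex)
qed

lemma multiplicity_sigma_self:
  assumes "prime p"
  shows "multiplicity p (sigma (p ^ c)) = 0"
proof -
  have "(\<Sum>i<c + 1. p ^ i) = 1 + p * (\<Sum>i<c. p ^ i)"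
    by (simp add: sum.lessThan_Suc_shift sum_distrib_left del: sum.lessThan_Suc)
  hence "\<not> p dvd (\<Sum>i<c + 1. p ^ i)"
    using assms by (metis dvd_add_left_iff dvd_triv_left not_prime_unit)
  thus ?thesis using assms by (simp add: sigma_prime_power not_dvd_imp_multiplicity_0)
qed

subsection \<open>Auxiliary polynomials\<close>

text \<open>Vandermonde applied to \<open>a = (a - k) + k\<close> expands the second binomial, and
  each product is then regrouped as a binomial in \<open>a\<close>. Products of binomials thus
  return to the binomial basis with integer coefficients free of \<open>a\<close>.\<close>

lemma choose_mult_choose:
  "(a choose k) * (a choose j) = (\<Sum>i\<le>j. (k choose (j - i)) * ((k + i) choose k) * (a choose (k + i)))"
proof (cases "k \<le> a")
  case True
  have "(a choose k) * (a choose j) = (a choose k) * (\<Sum>i\<le>j. ((a - k) choose i) * (k choose (j - i)))"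
    using vandermonde[of "a - k" k j] True by simp
  also have "\<dots> = (\<Sum>i\<le>j. (k choose (j - i)) * ((a choose k) * ((a - k) choose i)))"
    by (simp add: sum_distrib_left mult_ac)
  also have "\<dots> = (\<Sum>i\<le>j. (k choose (j - i)) * ((k + i) choose k) * (a choose (k + i)))"
  proof (intro sum.cong refl)
    fix i assume "i \<in> {..j}"
    show "(k choose (j - i)) * ((a choose k) * ((a - k) choose i)) = (k choose (j - i)) * ((k + i) choose k) * (a choose (k + i))"
    proof (cases "k + i \<le> a")
      case True
      thus ?thesis using choose_mult[of k "k + i" a] by (simp add: mult_ac)
    next
      case False
      hence "a < k \<or> a - k < i" by linarith
      thus ?thesis using False by (auto simp: binomial_eq_0)
    qed
  qed
  finally show ?thesis .
next
  case False
  thus ?thesis by (simp add: binomial_eq_0)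
qed

text \<open>The truncated power series is multiplied by a binomial and re-expanded in the binomial
  basis. The essential point is that \<open>e\<close> serves all \<open>a\<close> at once, which
  makes the later conditions linear in the unknown coefficients.\<close>

lemma choose_mult_power_expansion:
  fixes u P :: int
  shows "\<exists>e. \<forall>k<K. \<forall>a. [of_nat (a choose k) * (1 + P * u) ^ a
            = (\<Sum>m<K + w. e m k * of_nat (a choose m))] (mod P ^ w)"
proof -
  \<comment> \<open>\<open>c k i\<close> collects the coefficient of the binomial of index
    \<open>k + i\<close> over all orders \<open>j\<close>; \<open>e\<close> is the same array
    indexed by \<open>m = k + i\<close>.\<close>
  define c where "c k i = (\<Sum>j<w. if i \<le> j then (P * u) ^ j * of_nat (k choose (j - i)) * of_nat ((k + i) choose k) else 0)" for k i
  define e where "e m k = (if k \<le> m \<and> m < k + w then c k (m - k) else 0)" for m k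
  have "[of_nat (a choose k) * (1 + P * u) ^ a = (\<Sum>m<K + w. e m k * of_nat (a choose m))] (mod P ^ w)"
    if "k < K" for k a
  proof -
    have "[of_nat (a choose k) * (1 + P * u) ^ a = of_nat (a choose k) * (\<Sum>j<w. of_nat (a choose j) * (P * u) ^ j)] (mod P ^ w)"
      by (intro cong_mult cong_refl one_plus_mult_power_cong)
    also have "of_nat (a choose k) * (\<Sum>j<w. of_nat (a choose j) * (P * u) ^ j)
        = (\<Sum>j<w. (P * u) ^ j * of_nat ((a choose k) * (a choose j)))"
      by (simp add: sum_distrib_left mult_ac)
    also have "\<dots> = (\<Sum>j<w. \<Sum>i<w. if i \<le> j then (P * u) ^ j * of_nat (k choose (j - i)) * of_nat ((k + i) choose k) * of_nat (a choose (k + i)) else 0)"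
    proof (intro sum.cong refl)
      fix j assume "j \<in> {..<w}"
      hence *: "{i. i < w \<and> i \<le> j} = {..j}" by auto
      show "(P * u) ^ j * of_nat ((a choose k) * (a choose j)) = (\<Sum>i<w. if i \<le> j then (P * u) ^ j * of_nat (k choose (j - i)) * of_nat ((k + i) choose k) * of_nat (a choose (k + i)) else 0)"
        unfolding choose_mult_choose[of a k j]
        by (subst sum.inter_filter[symmetric]) (simp_all add: * sum_distrib_left mult_ac)
    qed
    also have "\<dots> = (\<Sum>i<w. c k i * of_nat (a choose (k + i)))"
      unfolding c_def by (subst sum.swap) (auto simp: sum_distrib_right intro!: sum.cong)
    also have "\<dots> = (\<Sum>m\<in>{k..<k + w}. c k (m - k) * of_nat (a choose m))"
      by (rule sum.reindex_bij_witness[of _ "\<lambda>m. m - k" "\<lambda>i. k + i"]) auto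
    also have "\<dots> = (\<Sum>m<K + w. e m k * of_nat (a choose m))"
      unfolding e_def by (rule sum.mono_neutral_cong_left) (use that in auto)
    finally show ?thesis .
  qed
  thus ?thesis by blast
qed

text \<open>Box principle: there are more coefficient vectors in the box than residue vectors, so
  two of them collide, and their difference is the small nontrivial solution.\<close>

lemma small_solution_mod:
  fixes e :: "nat \<Rightarrow> nat \<Rightarrow> int" and M HA HB N K :: nat
  assumes "M > 0" "M ^ N < HA ^ N * HB ^ K"
  shows "\<exists>A B. ((\<exists>m<N. A m \<noteq> 0) \<or> (\<exists>k<K. B k \<noteq> 0)) \<and>
           (\<forall>m<N. \<bar>A m\<bar> < int HA) \<and> (\<forall>k<K. \<bar>B k\<bar> < int HB) \<and>
           (\<forall>m<N. int M dvd A m + (\<Sum>k<K. e m k * B k))"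
proof -
  define X where "X = PiE {..<N} (\<lambda>_. {0..<int HA}) \<times> PiE {..<K} (\<lambda>_. {0..<int HB})"
  define Y where "Y = PiE {..<N} (\<lambda>_. {0..<int M})"
  define \<phi> where "\<phi> = (\<lambda>(A, B). \<lambda>m\<in>{..<N}. (A m + (\<Sum>k<K. e m k * B k)) mod int M)"
  have "finite Y" unfolding Y_def by (intro finite_PiE) auto
  moreover have "\<phi> ` X \<subseteq> Y"
    unfolding \<phi>_def Y_def using assms(1) by (intro image_subsetI) (simp split: prod.split)
  ultimately have "card (\<phi> ` X) \<le> card Y" by (rule card_mono)
  also have "card Y = M ^ N" by (simp add: Y_def card_PiE)
  also have "\<dots> < card X"
    using assms(2) by (simp add: X_def card_cartesian_product card_PiE)
  finally have "\<not> inj_on \<phi> X" by (rule pigeonhole)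
  then obtain A B A' B' where AB: "(A, B) \<in> X" "(A', B') \<in> X" "(A, B) \<noteq> (A', B')" "\<phi> (A, B) = \<phi> (A', B')"
    unfolding inj_on_def by (metis surj_pair)
  have A: "A \<in> PiE {..<N} (\<lambda>_. {0..<int HA})" "A' \<in> PiE {..<N} (\<lambda>_. {0..<int HA})"
   and B: "B \<in> PiE {..<K} (\<lambda>_. {0..<int HB})" "B' \<in> PiE {..<K} (\<lambda>_. {0..<int HB})"
    using AB by (auto simp: X_def)
  show ?thesis
  proof (intro exI conjI allI impI)
    show "(\<exists>m<N. A m - A' m \<noteq> 0) \<or> (\<exists>k<K. B k - B' k \<noteq> 0)"
      using AB(3) PiE_ext[OF A] PiE_ext[OF B] by auto
  next
    fix m assume "m < N"
    thus "\<bar>A m - A' m\<bar> < int HA" using PiE_mem[OF A(1), of m] PiE_mem[OF A(2), of m] by auto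
    have "\<phi> (A, B) m = \<phi> (A', B') m" using AB(4) by simp
    hence "[A m + (\<Sum>k<K. e m k * B k) = A' m + (\<Sum>k<K. e m k * B' k)] (mod int M)"
      using \<open>m < N\<close> by (simp add: \<phi>_def cong_def)
    thus "int M dvd A m - A' m + (\<Sum>k<K. e m k * (B k - B' k))"
      by (simp add: cong_iff_dvd_diff algebra_simps sum_subtractf)
  next
    fix k assume "k < K"
    thus "\<bar>B k - B' k\<bar> < int HB" using PiE_mem[OF B(1), of k] PiE_mem[OF B(2), of k] by auto
  qed
qed

text \<open>Eliminating the unknown \<open>y\<close> from the two equations gives a polynomial
  \<open>W\<close> with more roots than its degree allows. Translation keeps leading coefficients,
  so \<open>W = 0\<close> forces one of \<open>P\<close>, \<open>Q\<close> to vanish, and then the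
  other has too many roots as well.\<close>

lemma translate_zero_estimate:
  fixes P Q :: "real poly" and X :: "real set"
  assumes "\<gamma>1 \<noteq> \<gamma>2" "finite X" "degree P + degree Q < card X"
    and "\<And>x. x \<in> X \<Longrightarrow> \<exists>y. y \<noteq> 0 \<and> poly P (x + a1) + poly Q (x + a1) * (y * \<gamma>1) = 0
            \<and> poly P (x + a2) + poly Q (x + a2) * (y * \<gamma>2) = 0"
    and "\<gamma>1 \<noteq> 0"
  shows "P = 0 \<and> Q = 0"
proof -
  have many: "R = 0" if "degree R < card X" "\<And>x. x \<in> X \<Longrightarrow> poly R x = 0" for R :: "real poly"
  proof (rule ccontr)
    assume "R \<noteq> 0"
    hence "card X \<le> card {x. poly R x = 0}"
      using that by (intro card_mono poly_roots_finite) auto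
    also have "\<dots> \<le> degree R" using \<open>R \<noteq> 0\<close> by (rule card_poly_roots_bound)
    finally show False using that by simp
  qed
  define sh where "sh = (\<lambda>(R :: real poly) a. R \<circ>\<^sub>p [:a, 1:])"
  have sh: "poly (sh R a) x = poly R (x + a)" "sh R a = 0 \<longleftrightarrow> R = 0" for R a x
    by (auto simp: sh_def poly_pcompose add.commute pcompose_eq_0_iff)
  have sh_deg: "degree (sh R a) = degree R" for R a
    by (simp add: sh_def degree_pcompose)
  have sh_lc: "lead_coeff (sh R a) = lead_coeff R" for R a
    unfolding sh_def by (subst lead_coeff_comp) auto
  define W where "W = smult \<gamma>2 (sh P a1 * sh Q a2) - smult \<gamma>1 (sh P a2 * sh Q a1)"
  have "degree W \<le> degree P + degree Q"
    unfolding W_def by (intro degree_diff_le order.trans[OF degree_smult_le] order.trans[OF degree_mult_le]) (auto simp: sh_deg)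
  moreover have "poly W x = 0" if x: "x \<in> X" for x
  proof -
    from assms(4)[OF x] obtain y where y: "poly P (x + a1) = - poly Q (x + a1) * (y * \<gamma>1)"
       "poly P (x + a2) = - poly Q (x + a2) * (y * \<gamma>2)" by (auto simp: eq_neg_iff_add_eq_0)
    show ?thesis by (simp add: W_def sh y)
  qed
  ultimately have "W = 0" using assms(3) by (intro many) auto
  \<comment> \<open>In this degree both products have the same coefficient, so only the factor
    \<open>\<gamma>2 - \<gamma>1\<close> survives.\<close>
  hence "coeff W (degree P + degree Q) = 0" by simp
  moreover have "coeff (sh P a * sh Q b) (degree P + degree Q) = lead_coeff P * lead_coeff Q" for a b
    using coeff_mult_degree_sum[of "sh P a" "sh Q b"] by (metis sh_deg sh_lc)
  ultimately have "(\<gamma>2 - \<gamma>1) * (lead_coeff P * lead_coeff Q) = 0"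
    by (simp add: W_def algebra_simps)
  hence "P = 0 \<or> Q = 0" using assms(1) by auto
  moreover have "P = 0" if "Q = 0"
  proof -
    have "sh P a1 = 0" using assms(3,4) that by (intro many) (auto simp: sh sh_deg)
    thus ?thesis by (simp add: sh)
  qed
  moreover have "Q = 0" if "P = 0"
  proof -
    have "sh Q a1 = 0" using assms(3,4,5) that by (intro many) (fastforce simp: sh sh_deg)+
    thus ?thesis by (simp add: sh)
  qed
  ultimately show ?thesis by blast
qed

text \<open>Real polynomials make root counting available; the basis consists of falling factorials
  divided by \<open>fact m\<close>.\<close>

lemma binomial_combination_poly:
  fixes A :: "nat \<Rightarrow> int"
  assumes "N > 0"
  shows "\<exists>P :: real poly. degree P < N \<and> (\<forall>a. poly P (real a) = of_int (\<Sum>m<N. A m * of_nat (a choose m)))"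
proof -
  define b where "b = (\<lambda>m. smult (1 / fact m) (\<Prod>i<m. [:- real i, 1:]))"
  have b: "poly (b m) (real a) = real (a choose m)" for m a
    by (simp add: b_def poly_prod binomial_gbinomial gbinomial_prod_rev atLeast0LessThan)
  have "degree (\<Prod>i<m. [:- real i, 1:]) = m" for m
    by (subst degree_prod_eq_sum_degree) auto
  hence deg: "degree (b m) \<le> m" for m using degree_smult_le[of "1 / fact m" "\<Prod>i<m. [:- real i, 1:]"] by (simp add: b_def)
  define P where "P = (\<Sum>m<N. smult (of_int (A m)) (b m))"
  have "degree P \<le> N - 1"
    unfolding P_def
    by (intro degree_sum_le order.trans[OF degree_smult_le] order.trans[OF deg]) auto
  moreover have "poly P (real a) = of_int (\<Sum>m<N. A m * of_nat (a choose m))" for a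
    by (simp add: P_def poly_sum b)
  ultimately show ?thesis using assms by (intro exI[of _ P]) auto
qed

text \<open>The system is triangular: evaluation at \<open>m\<close> kills the binomials of larger
  index, and induction those of smaller index.\<close>

lemma binomial_combination_eq_0:
  fixes A :: "nat \<Rightarrow> int"
  assumes "\<And>a. (\<Sum>m<N. A m * of_nat (a choose m)) = 0" "m < N"
  shows "A m = 0"
  using assms(2)
proof (induction m rule: less_induct)
  case (less m)
  have "0 = (\<Sum>i<N. A i * of_nat (m choose i))" using assms(1) by simp
  also have "\<dots> = (\<Sum>i\<in>{m}. A i * of_nat (m choose i))"
  proof (rule sum.mono_neutral_right)
    show "\<forall>i\<in>{..<N} - {m}. A i * of_nat (m choose i) = 0"
    proof
      fix i assume "i \<in> {..<N} - {m}"
      thus "A i * of_nat (m choose i) = 0" using less.IH[of i] by (cases "i < m") (auto simp: binomial_eq_0)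
    qed
  qed (use less.prems in auto)
  finally show ?case by simp
qed

subsection \<open>Powers in a residue class\<close>

text \<open>The cofactor of \<open>a - b\<close> in \<open>a ^ p - b ^ p\<close> is
  \<open>p * b ^ (p - 1)\<close> modulo \<open>p\<close>, which supplies the extra factor
  \<open>p\<close>.\<close>

lemma pow_p_cong_lift:
  fixes a b p k :: nat
  assumes "prime p" "[a = b] (mod p ^ k)" "k > 0"
  shows "[a ^ p = b ^ p] (mod p ^ Suc k)"
proof -
  have ab: "[int a = int b] (mod int p)"
    using assms by (metis cong_dvd_modulus_nat cong_int_iff dvd_power of_nat_power)
  have "[(\<Sum>i<p. int b ^ (p - Suc i) * int a ^ i) = (\<Sum>i<p. int b ^ (p - Suc i) * int b ^ i)] (mod int p)"
    by (intro cong_sum cong_mult cong_pow ab cong_refl)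
  also have "(\<Sum>i<p. int b ^ (p - Suc i) * int b ^ i) = (\<Sum>i<p. int b ^ (p - 1))"
    by (intro sum.cong refl) (auto simp flip: power_add)
  also have "\<dots> = int p * int b ^ (p - 1)" by simp
  finally have "int p dvd (\<Sum>i<p. int b ^ (p - Suc i) * int a ^ i)"
    by (simp add: cong_dvd_iff)
  moreover have "int p ^ k dvd int a - int b"
    using assms(2) by (metis cong_iff_dvd_diff cong_int_iff of_nat_power)
  ultimately have "int p ^ k * int p dvd (int a - int b) * (\<Sum>i<p. int b ^ (p - Suc i) * int a ^ i)"
    by (intro mult_dvd_mono)
  also have "\<dots> = int a ^ p - int b ^ p"
    by (subst power_diff_sumr2) (simp add: mult.commute)
  finally have "[int a ^ p = int b ^ p] (mod int (p ^ Suc k))"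
    by (simp add: cong_iff_dvd_diff mult.commute)
  thus ?thesis by (metis cong_int_iff of_nat_power)
qed

lemma pow_prime_power_cong:
  fixes a b p k :: nat
  assumes "prime p" "[a = b] (mod p)"
  shows "[a ^ (p ^ k) = b ^ (p ^ k)] (mod p ^ Suc k)"
proof (induction k)
  case (Suc k)
  from pow_p_cong_lift[OF assms(1) Suc] show ?case
    by (simp add: power_mult[symmetric] mult.commute)
qed (use assms in auto)

text \<open>Raising to the power \<open>P = p ^ (v - 1)\<close> turns congruences modulo
  \<open>p\<close> into congruences modulo \<open>p ^ v\<close>, and fixes \<open>q\<close> modulo
  \<open>p ^ v\<close> because \<open>P\<close> is 1 modulo \<open>p - 1\<close>. Comparing
  \<open>r ^ a * q ^ b\<close> with its \<open>P\<close>-th power leaves the constant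
  \<open>c ^ P\<close> and one factor \<open>\<eta>\<close> per factor \<open>r\<close>.\<close>

lemma residue_class_exponential:
  fixes p r q v c :: nat
  assumes "prime p" "v > 0" "\<not> p dvd r" "[q ^ (p - 1) = 1] (mod p ^ v)"
  shows "\<exists>\<eta> C. [\<eta> = 1] (mod p) \<and>
           (\<forall>a b. [r ^ a * q ^ b = c] (mod p) \<longrightarrow> [r ^ a * q ^ b = C * \<eta> ^ a] (mod p ^ v))"
proof -
  define P where "P = p ^ (v - 1)"
  \<comment> \<open>This is \<open>r\<close> to the power \<open>1 - P\<close>, made nonnegative by
    adding \<open>P * (p - 1)\<close>, the totient of \<open>p ^ v\<close>.\<close>
  define \<eta> where "\<eta> = r ^ (1 + P * (p - 2))"
  have p: "p > 1" using assms(1) by (rule prime_gt_1_nat)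
  have pv: "p ^ v = p ^ Suc (v - 1)" using assms(2) by simp
  have "P mod (p - 1) = 1 mod (p - 1)"
  proof -
    have "[p ^ (v - 1) = 1 ^ (v - 1)] (mod (p - 1))"
      using p by (intro cong_pow) (simp add: cong_altdef_nat)
    thus ?thesis by (simp add: P_def cong_def)
  qed
  hence P1: "[P = 1] (mod (p - 1))" by (simp add: cong_def)
  have "P \<ge> 1" using p by (simp add: P_def)
  with P1 obtain s where s: "P = 1 + (p - 1) * s"
    by (metis cong_altdef_nat dvdE le_add_diff_inverse cong_sym)
  have qP: "[q ^ P = q] (mod p ^ v)"
  proof -
    have "[q * (q ^ (p - 1)) ^ s = q * 1 ^ s] (mod p ^ v)"
      by (intro cong_mult cong_pow assms cong_refl)
    thus ?thesis by (simp add: s power_add power_mult)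
  qed
  have "1 + P * (p - 2) = (p - 1) * (1 + (p - 2) * s)"
  proof -
    obtain t where "p = t + 2" using p le_add_diff_inverse2[of 2 p] that[of "p - 2"] by simp
    thus ?thesis by (simp add: s algebra_simps)
  qed
  hence "\<eta> = (r ^ (p - 1)) ^ (1 + (p - 2) * s)"
    unfolding \<eta>_def by (metis power_mult)
  moreover have "[(r ^ (p - 1)) ^ (1 + (p - 2) * s) = 1 ^ (1 + (p - 2) * s)] (mod p)"
    by (intro cong_pow fermat_theorem assms)
  ultimately have eta1: "[\<eta> = 1] (mod p)" by simp
  have "coprime r (p ^ v)"
    using assms(1,3) by (metis coprime_commute coprime_power_left_iff prime_imp_coprime)
  hence "[r ^ totient (p ^ v) = 1] (mod p ^ v)" by (rule euler_theorem)
  hence rtot: "[r ^ (P * (p - 1)) = 1] (mod p ^ v)"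
    using assms(1,2) by (simp add: totient_prime_power P_def)
  have eta: "[\<eta> * r ^ P = r] (mod p ^ v)"
  proof -
    have "p - 1 = Suc (p - 2)" using p by simp
    hence "P * (p - 1) = P * (p - 2) + P" by simp
    hence "\<eta> * r ^ P = r * r ^ (P * (p - 1))" by (simp add: \<eta>_def power_add)
    also have "[\<dots> = r * 1] (mod p ^ v)" by (intro cong_mult cong_refl rtot)
    finally show ?thesis by simp
  qed
  have "[r ^ a * q ^ b = c ^ P * \<eta> ^ a] (mod p ^ v)" if "[r ^ a * q ^ b = c] (mod p)" for a b
  proof -
    have "[(\<eta> * r ^ P) ^ a * (q ^ P) ^ b = r ^ a * q ^ b] (mod p ^ v)"
      by (intro cong_mult cong_pow eta qP)
    moreover have "(\<eta> * r ^ P) ^ a * (q ^ P) ^ b = (r ^ a * q ^ b) ^ P * \<eta> ^ a"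
      by (simp add: power_mult_distrib mult_ac flip: power_mult)
    moreover have "[(r ^ a * q ^ b) ^ P * \<eta> ^ a = c ^ P * \<eta> ^ a] (mod p ^ v)"
      unfolding pv P_def by (intro cong_mult cong_refl pow_prime_power_cong assms(1) that)
    ultimately show ?thesis by (metis cong_sym cong_trans)
  qed
  with eta1 show ?thesis by blast
qed

section \<open>Counting and size estimates for the box\<close>

lemma pigeonhole_fibre:
  assumes "finite X" "finite Y" "f ` X \<subseteq> Y" "card Y * n \<le> card X" "Y \<noteq> {}"
  shows "\<exists>y\<in>Y. n \<le> card {x \<in> X. f x = y}"
proof (rule ccontr)
  assume "\<not> ?thesis"
  hence "card {x \<in> X. f x = y} < n" if "y \<in> Y" for y using that by force
  hence "(\<Sum>y\<in>Y. card {x \<in> X. f x = y}) < (\<Sum>y\<in>Y. n)"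
    using assms by (intro sum_strict_mono) auto
  moreover have "(\<Sum>y\<in>Y. card {x \<in> X. f x = y}) = card X"
    using sum.group[OF assms(1-3), of "\<lambda>_. 1 :: nat"] by simp
  ultimately show False using assms(4) by simp
qed

text \<open>Cancelling \<open>r ^ a\<close> would make \<open>r\<close> divide a power of
  \<open>q\<close>. This is the multiplicative independence that separates the two points used for
  the translates.\<close>

lemma coprime_power_products_distinct:
  fixes r q :: nat
  assumes "coprime r q" "r \<ge> 2" "a < a'" "q > 0"
  shows "r ^ a * q ^ b \<noteq> r ^ a' * q ^ b'"
proof
  assume eq: "r ^ a * q ^ b = r ^ a' * q ^ b'"
  have "r ^ a' = r ^ a * (r * r ^ (a' - a - 1))"
    using assms(3) by (simp flip: power_Suc power_add)
  hence "q ^ b = r * (r ^ (a' - a - 1) * q ^ b')" using eq assms(2) by simp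
  hence "r dvd q ^ b" by simp
  moreover have "coprime r (q ^ b)" using assms(1) by simp
  ultimately show False using assms(2) coprime_common_divisor_nat[of r "q ^ b" r] by simp
qed

text \<open>The binomials of one row add up to \<open>2 ^ a\<close>, so the bound does not depend on
  the number \<open>N\<close> of terms.\<close>

lemma binomial_combination_abs_le:
  fixes A :: "nat \<Rightarrow> int"
  assumes "\<And>m. m < N \<Longrightarrow> \<bar>A m\<bar> \<le> h" "a \<le> t" "h \<ge> 0"
  shows "\<bar>\<Sum>m<N. A m * of_nat (a choose m)\<bar> \<le> h * 2 ^ t"
proof -
  have "\<bar>\<Sum>m<N. A m * of_nat (a choose m)\<bar> \<le> (\<Sum>m<N. h * of_nat (a choose m))"
    by (rule order.trans[OF sum_abs]) (auto simp: abs_mult intro!: sum_mono mult_right_mono assms)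
  also have "\<dots> = h * of_nat (\<Sum>m<N. a choose m)" by (simp add: sum_distrib_left)
  also have "(\<Sum>m<N. a choose m) \<le> (\<Sum>m\<le>a. a choose m)"
  proof -
    have "(\<Sum>m<N. a choose m) \<le> (\<Sum>m\<in>{..<N} \<union> {..a}. a choose m)" by (intro sum_mono2) auto
    also have "\<dots> = (\<Sum>m\<le>a. a choose m)" by (rule sum.mono_neutral_right) auto
    finally show ?thesis .
  qed
  also have "\<dots> = 2 ^ a" by (rule choose_row_sum)
  also have "(2 :: nat) ^ a \<le> 2 ^ t" using assms(2) by simp
  finally show ?thesis using assms(3) by (simp add: mult_left_mono)
qed

text \<open>Were \<open>p ^ v\<close> at least the right-hand side, there would be room for an
  auxiliary pair of polynomials whose values on the doubled box are smaller than
  \<open>p ^ v\<close>, hence zero on one class. The zero estimate excludes this.\<close>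

lemma modulus_less_of_box:
  fixes p r q v R S :: nat
  assumes p: "prime p" and r: "2 \<le> r" and q: "2 \<le> q" and cop: "coprime r q"
    and pr: "\<not> p dvd r" and pq: "\<not> p dvd q" and v: "v > 0"
    and qv: "[q ^ (p - 1) = 1] (mod p ^ v)" and S: "S \<le> ord p q"
    and RS: "3 * v * (p - 1) \<le> R * S"
  shows "p ^ v < 32 * r ^ (8 * (R - 1)) * q ^ (2 * (S - 1))"
proof (rule ccontr)
  assume "\<not> ?thesis"
  hence large: "32 * r ^ (8 * (R - 1)) * q ^ (2 * (S - 1)) \<le> p ^ v" by simp
  have p1: "p > 1" using p by (rule prime_gt_1_nat)
  have pos: "R > 0" "S > 0" using RS v p1 by (auto intro!: Nat.gr0I)
  define f where "f = (\<lambda>(a, b). r ^ a * q ^ b mod p)"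
  \<comment> \<open>The products are prime to \<open>p\<close>, so only \<open>p - 1\<close> classes
    share the \<open>R * S\<close> points.\<close>
  have "\<exists>c\<in>{1..<p}. 3 * v \<le> card {z \<in> {..<R} \<times> {..<S}. f z = c}"
  proof (rule pigeonhole_fibre)
    show "f ` ({..<R} \<times> {..<S}) \<subseteq> {1..<p}"
    proof (clarsimp simp: f_def p1 Suc_le_eq)
      fix a b
      have "\<not> p dvd r ^ a * q ^ b"
        using p pr pq by (auto simp: prime_dvd_mult_iff dest: prime_dvd_power)
      thus "0 < r ^ a * q ^ b mod p \<and> r ^ a * q ^ b mod p < p" using p1 by (auto simp: dvd_eq_mod_eq_0)
    qed
  qed (use p1 RS in \<open>auto simp: mult_ac\<close>)
  then obtain c where c: "3 * v \<le> card {z \<in> {..<R} \<times> {..<S}. f z = c}" by blast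
  define Z where "Z = {z \<in> {..<R} \<times> {..<S}. f z = c}"
  have Z: "a < R" "b < S" "r ^ a * q ^ b mod p = c" if "(a, b) \<in> Z" for a b
    using that by (auto simp: Z_def f_def)
  have finZ: "finite Z" by (auto simp: Z_def)
  have copq: "coprime p q" "coprime p r" using p pq pr by (simp_all add: prime_imp_coprime_nat)
  \<comment> \<open>Since \<open>S\<close> is at most the order of \<open>q\<close>, the exponent of
    \<open>r\<close> determines a point of the class. Distinct points thus give distinct arguments
    for the polynomials.\<close>
  have injZ: "inj_on fst Z"
  proof (rule inj_onI)
    fix z z' assume z: "z \<in> Z" "z' \<in> Z" "fst z = fst z'"
    obtain a b b' where eq: "z = (a, b)" "z' = (a, b')" using z(3) by (cases z; cases z') auto
    have "[r ^ a * q ^ b = r ^ a * q ^ b'] (mod p)" using z Z eq by (simp add: cong_def)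
    hence "[q ^ b = q ^ b'] (mod p)"
      using copq by (subst (asm) cong_mult_lcancel_nat) (auto simp: coprime_commute)
    hence "[b = b'] (mod ord p q)" using order_divides_expdiff[OF copq(1)] by simp
    moreover have "b < ord p q" "b' < ord p q" using z Z eq S by fastforce+
    ultimately show "z = z'" by (simp add: eq cong_less_imp_eq_nat)
  qed
  obtain a1 b1 a2 b2 where z12: "(a1, b1) \<in> Z" "(a2, b2) \<in> Z" "a1 < a2"
  proof -
    have "card Z \<ge> 2" using c v by (simp add: Z_def)
    then obtain z z' where "z \<in> Z" "z' \<in> Z" "z \<noteq> z'" by (metis card_2_iff' obtain_subset_with_card_n subsetD)
    moreover from this have "fst z \<noteq> fst z'" using injZ by (auto dest: inj_onD)
    ultimately show ?thesis using that by (metis linorder_neqE_nat prod.collapse)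
  qed
  define X where "X = (\<lambda>z. real (fst z)) ` Z"
  have "card X = card Z" unfolding X_def
    using injZ by (intro card_image) (auto simp: inj_on_def)
  hence cardX: "card X \<ge> 3 * v" using c by (simp add: Z_def)

  \<comment> \<open>Only sums of two points of \<open>Z\<close> will be evaluated: \<open>t\<close>
    bounds their first exponent, \<open>T\<close> the row sum of binomials, and \<open>Y\<close> the
    value of the product.\<close>
  define t where "t = 2 * (R - 1)"
  define T where "T = (2 :: nat) ^ t"
  define Y where "Y = r ^ t * q ^ (2 * (S - 1))"
  define M where "M = p ^ v"
  have T0: "T > 0" by (simp add: T_def)
  have Y0: "Y > 0" using r q by (simp add: Y_def)
  have TY: "32 * T ^ 3 * Y \<le> M"
  proof -
    have "T ^ 3 \<le> (r ^ t) ^ 3" unfolding T_def using r by (intro power_mono) auto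
    hence "32 * T ^ 3 * Y \<le> 32 * (r ^ t) ^ 3 * Y" by simp
    also have "\<dots> = 32 * r ^ (8 * (R - 1)) * q ^ (2 * (S - 1))"
      by (simp add: Y_def t_def mult_ac flip: power_mult power_add)
    finally show ?thesis using large by (simp add: M_def)
  qed
  \<comment> \<open>The sizes are balanced: \<open>HA * T\<close> and \<open>HB * T * Y\<close> are
    each at most half of \<open>M\<close>, while \<open>M < 4 * T * HA\<close> gives
    \<open>M ^ 2 < HA ^ 2 * HB\<close>, the count needed for the box principle.\<close>
  define HA where "HA = M div (2 * T)"
  define HB where "HB = 16 * T\<^sup>2"
  have HAle: "2 * T * HA \<le> M" by (simp add: HA_def)
  have TM: "2 * T \<le> M"
  proof -
    have "2 * T * 1 \<le> 2 * T * (16 * T\<^sup>2 * Y)" using T0 Y0 by (intro mult_le_mono) auto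
    also have "\<dots> = 32 * T ^ 3 * Y" by (simp add: power2_eq_square power3_eq_cube)
    finally show ?thesis using TY by linarith
  qed
  hence HA1: "HA \<ge> 1" using T0 by (simp add: HA_def Suc_leI div_greater_zero_iff)
  have "M < 2 * T * (HA + 1)" unfolding HA_def
    using T0 by (simp add: dividend_less_times_div mult.commute)
  also have "\<dots> \<le> 2 * T * (2 * HA)" using HA1 by (intro mult_le_mono) auto
  finally have "M ^ 2 < (4 * T * HA) ^ 2" by (intro power_strict_mono) auto
  hence "M ^ 2 < HA ^ 2 * HB" by (simp add: HB_def power_mult_distrib mult_ac)
  hence "(M ^ 2) ^ v < (HA ^ 2 * HB) ^ v" using v by (intro power_strict_mono) auto
  \<comment> \<open>There are \<open>v\<close> unknowns for \<open>B\<close>. Multiplication by the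
    truncated exponential of \<open>v\<close> terms raises the number of binomials, and so of
    congruences, to \<open>v + v\<close>.\<close>
  hence count: "M ^ (v + v) < HA ^ (v + v) * HB ^ v"
    by (simp add: power_mult_distrib mult_2 flip: power_mult)

  \<comment> \<open>The sum of two exponent pairs from class \<open>c\<close> lies in class
    \<open>c * c\<close>, so that is the class where the relation is imposed.\<close>
  obtain \<eta> C where eta: "[\<eta> = 1] (mod p)"
    and cls: "\<And>a b. [r ^ a * q ^ b = c * c] (mod p) \<Longrightarrow> [r ^ a * q ^ b = C * \<eta> ^ a] (mod p ^ v)"
    using residue_class_exponential[OF p v pr qv, of "c * c"] by blast
  have "[int \<eta> = 1] (mod int p)" using eta by (metis cong_int_iff of_nat_1)
  then obtain u where u: "int \<eta> = 1 + int p * u" by (metis cong_iff_lin cong_sym)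
  obtain e where e: "\<And>k a. k < v \<Longrightarrow> [of_nat (a choose k) * (1 + int p * u) ^ a
            = (\<Sum>m<v + v. e m k * of_nat (a choose m))] (mod int p ^ v)"
    using choose_mult_power_expansion[of v "int p" u v] by blast
  obtain A B where nz: "(\<exists>m<v + v. A m \<noteq> 0) \<or> (\<exists>k<v. B k \<noteq> 0)"
    and A: "\<And>m. m < v + v \<Longrightarrow> \<bar>A m\<bar> < int HA" and B: "\<And>k. k < v \<Longrightarrow> \<bar>B k\<bar> < int HB"
    and AB: "\<And>m. m < v + v \<Longrightarrow> int M dvd A m + (\<Sum>k<v. (int C * e m k) * B k)"
    using small_solution_mod[OF _ count, of "\<lambda>m k. int C * e m k"] p1 by (auto simp: M_def)
  define FA where "FA a = (\<Sum>m<v + v. A m * of_nat (a choose m))" for a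
  define FB where "FB a = (\<Sum>k<v. B k * of_nat (a choose k))" for a

  \<comment> \<open>The expression is divisible by \<open>M\<close> by construction and smaller than
    \<open>M\<close> in absolute value.\<close>
  have vanish: "FA a + FB a * int (r ^ a * q ^ b) = 0"
    if ab: "[r ^ a * q ^ b = c * c] (mod p)" "a \<le> t" "b \<le> 2 * (S - 1)" for a b
  proof -
    have "[int (r ^ a * q ^ b) = int (C * \<eta> ^ a)] (mod int (p ^ v))"
      using cls[OF ab(1)] by (simp only: cong_int_iff)
    hence y: "[int (r ^ a * q ^ b) = int C * (1 + int p * u) ^ a] (mod int M)"
      by (simp add: M_def flip: u)
    have "[FA a + FB a * int (r ^ a * q ^ b) = FA a + FB a * (int C * (1 + int p * u) ^ a)] (mod int M)"
      by (intro cong_add cong_mult cong_refl y)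
    also have "FB a * (int C * (1 + int p * u) ^ a)
        = (\<Sum>k<v. int C * B k * (of_nat (a choose k) * (1 + int p * u) ^ a))"
      unfolding FB_def sum_distrib_right by (simp add: mult_ac)
    also have "[FA a + (\<Sum>k<v. int C * B k * (of_nat (a choose k) * (1 + int p * u) ^ a))
        = FA a + (\<Sum>k<v. int C * B k * (\<Sum>m<v + v. e m k * of_nat (a choose m)))] (mod int M)"
      by (intro cong_add cong_refl cong_sum cong_mult) (use e in \<open>auto simp: M_def\<close>)
    also have "(\<Sum>k<v. int C * B k * (\<Sum>m<v + v. e m k * of_nat (a choose m)))
        = (\<Sum>m<v + v. (\<Sum>k<v. (int C * e m k) * B k) * of_nat (a choose m))"
      unfolding sum_distrib_left sum_distrib_right
      by (subst sum.swap) (simp add: mult_ac)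
    also have "FA a + \<dots> = (\<Sum>m<v + v. (A m + (\<Sum>k<v. (int C * e m k) * B k)) * of_nat (a choose m))"
      by (simp only: FA_def sum.distrib[symmetric] distrib_right)
    also have "[\<dots> = 0] (mod int M)"
      unfolding cong_0_iff by (intro dvd_sum dvd_mult2 AB) auto
    finally have dvd: "int M dvd FA a + FB a * int (r ^ a * q ^ b)" by (simp add: cong_0_iff)
    have "\<bar>FA a\<bar> \<le> int (HA - 1) * 2 ^ t"
      unfolding FA_def by (rule binomial_combination_abs_le) (use A ab(2) HA1 in \<open>force+\<close>)
    also have "\<dots> < int (HA * T)" using HA1 by (simp add: T_def of_nat_diff algebra_simps)
    finally have 1: "\<bar>FA a\<bar> < int (HA * T)" .
    have "\<bar>FB a\<bar> \<le> int HB * 2 ^ t"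
      unfolding FB_def by (rule binomial_combination_abs_le) (use B ab(2) in \<open>force+\<close>)
    moreover have "r ^ a * q ^ b \<le> Y"
      unfolding Y_def using ab r q by (intro mult_le_mono power_increasing) auto
    ultimately have "\<bar>FB a\<bar> * int (r ^ a * q ^ b) \<le> (int HB * 2 ^ t) * int Y"
      by (intro mult_mono) (simp_all only: of_nat_le_iff of_nat_0_le_iff mult_nonneg_nonneg zero_le_power zero_le_numeral)
    also have "\<dots> = int (HB * T * Y)" by (simp add: T_def)
    finally have 2: "\<bar>FB a * int (r ^ a * q ^ b)\<bar> \<le> int (HB * T * Y)" by (simp add: abs_mult)
    have "2 * (HB * T * Y) \<le> M" using TY by (simp add: HB_def power2_eq_square power3_eq_cube mult_ac)
    moreover have "2 * (HA * T) \<le> M" using HAle by (simp add: mult_ac)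
    ultimately have "\<bar>FA a + FB a * int (r ^ a * q ^ b)\<bar> < int M" using 1 2 by linarith
    thus ?thesis using dvd_imp_le_int[OF _ dvd] by (metis abs_of_nat not_le)
  qed

  obtain P where P: "degree P < v + v" "\<And>a. poly P (real a) = of_int (FA a)"
    using binomial_combination_poly[of "v + v" A] v by (auto simp: FA_def)
  obtain Q where Q: "degree Q < v" "\<And>a. poly Q (real a) = of_int (FB a)"
    using binomial_combination_poly[of v B] v by (auto simp: FB_def)
  define \<gamma> where "\<gamma> a b = real (r ^ a * q ^ b)" for a b
  \<comment> \<open>The degrees add up to less than \<open>3 * v\<close>, the guaranteed number of
    points. The factor \<open>y\<close> is the product at the moving point, and
    \<open>\<gamma>1\<close>, \<open>\<gamma>2\<close> are the products at the two fixed
    ones.\<close>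
  have "P = 0 \<and> Q = 0"
  proof (rule translate_zero_estimate)
    show "\<gamma> a1 b1 \<noteq> \<gamma> a2 b2" unfolding \<gamma>_def of_nat_eq_iff
      by (rule coprime_power_products_distinct) (use cop r q z12 in auto)
    show "finite X" using finZ by (simp add: X_def)
    show "degree P + degree Q < card X" using cardX P(1) Q(1) by linarith
    show "\<gamma> a1 b1 \<noteq> 0" using r q by (simp add: \<gamma>_def)
  next
    fix x assume "x \<in> X"
    then obtain a b where ab: "(a, b) \<in> Z" "x = real a" by (auto simp: X_def)
    have *: "poly P (x + real a') + poly Q (x + real a') * (\<gamma> a b * \<gamma> a' b') = 0" if "(a', b') \<in> Z" for a' b'
    proof -
      have "[(r ^ a * q ^ b) * (r ^ a' * q ^ b') = c * c] (mod p)"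
        using Z(3)[OF ab(1)] Z(3)[OF that] by (intro cong_mult) (auto simp: cong_def)
      hence "[r ^ (a + a') * q ^ (b + b') = c * c] (mod p)" by (simp add: power_add mult_ac)
      hence "FA (a + a') + FB (a + a') * int (r ^ (a + a') * q ^ (b + b')) = 0"
        using Z(1,2)[OF ab(1)] Z(1,2)[OF that] by (intro vanish) (auto simp: t_def)
      hence "real_of_int (FA (a + a') + FB (a + a') * int (r ^ (a + a') * q ^ (b + b'))) = 0" by simp
      moreover have "x + real a' = real (a + a')" by (simp add: ab)
      ultimately show ?thesis by (simp only: P(2) Q(2)) (simp add: \<gamma>_def power_add mult_ac)
    qed
    have "\<gamma> a b \<noteq> 0" using r q by (simp add: \<gamma>_def)
    thus "\<exists>y. y \<noteq> 0 \<and> poly P (x + real a1) + poly Q (x + real a1) * (y * \<gamma> a1 b1) = 0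
            \<and> poly P (x + real a2) + poly Q (x + real a2) * (y * \<gamma> a2 b2) = 0"
      using *[OF z12(1)] *[OF z12(2)] by blast
  qed
  hence F0: "FA a = 0" "FB a = 0" for a using P(2)[of a] Q(2)[of a] by auto
  have "A m = 0" if "m < v + v" for m
    using F0(1) that unfolding FA_def by (rule binomial_combination_eq_0)
  moreover have "B k = 0" if "k < v" for k
    using F0(2) that unfolding FB_def by (rule binomial_combination_eq_0)
  ultimately show False using nz by blast
qed

subsection \<open>Valuation bounds\<close>

lemma multiplicity_times_ln_le:
  fixes p n :: nat
  assumes "p > 1" "n > 0"
  shows "real (multiplicity p n) * ln (real p) \<le> ln (real n)"
proof -
  have "p ^ multiplicity p n \<le> n" using assms by (intro dvd_imp_le multiplicity_dvd)
  hence "real (p ^ multiplicity p n) \<le> real n" by (simp only: of_nat_le_iff)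
  hence "ln (real (p ^ multiplicity p n)) \<le> ln (real n)" using assms by (subst ln_le_cancel_iff) auto
  thus ?thesis using assms by (simp add: ln_realpow)
qed

lemma one_le_ln:
  assumes "p \<ge> 3" shows "1 \<le> ln (real p)"
  using exp_le assms by (simp add: ln_ge_iff)

lemma ln_ge_half:
  assumes "x \<ge> 2" shows "1 / 2 \<le> ln (real x)"
  using order_trans[OF exp_half_le2, of "real x"] assms by (subst ln_ge_iff) auto

text \<open>It suffices that \<open>exp 1\<close> is at least \<open>1 + 1 + 1/2\<close>, as the
  fourth power of 5/2 exceeds 32.\<close>

lemma ln_32_le: "ln (32 :: real) \<le> 4"
proof -
  have "(32 :: real) \<le> (5 / 2) ^ 4" by (simp add: power_divide)
  also have "\<dots> \<le> exp 1 ^ 4" using exp_lower_Taylor_quadratic[of 1] by (intro power_mono) auto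
  also have "\<dots> = exp 4" by (simp flip: exp_of_nat_mult)
  finally have "ln (32 :: real) \<le> ln (exp 4)" by (subst ln_le_cancel_iff) auto
  thus ?thesis by simp
qed

text \<open>If the valuation exceeded the bound, a box could be chosen with enough points for the
  preceding inequality, yet so small that this inequality fails.\<close>

lemma multiplicity_ord_bound:
  fixes p r q :: nat
  assumes p: "prime p" "odd p" and r: "2 \<le> r" and q: "2 \<le> q" and cop: "coprime r q"
    and pr: "\<not> p dvd r" and pq: "\<not> p dvd q"
  shows "real (multiplicity p (q ^ ord p q - 1))
           \<le> 283 * (real p - 1) * ln (real r) * ln (real q) / (ln (real p))\<^sup>2 + 4"
proof (rule ccontr)
  define d where "d = ord p q"
  define v where "v = multiplicity p (q ^ d - 1)"
  define l where "l = ln (real p)"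
  define E where "E = ln (real r) * ln (real q)"
  assume "\<not> ?thesis"
  hence "283 * (real p - 1) * E / l\<^sup>2 < real v - 4" by (simp add: v_def d_def l_def E_def mult.assoc)
  moreover have p3: "p \<ge> 3" using p prime_ge_2_nat[of p] by (cases "p = 2") auto
  hence l: "l \<ge> 1" unfolding l_def by (rule one_le_ln)
  ultimately have main: "283 * (real p - 1) * E < (real v - 4) * l\<^sup>2"
    by (simp add: pos_divide_less_eq)
  have E: "E \<ge> 1 / 4" unfolding E_def using mult_mono[OF ln_ge_half[OF r] ln_ge_half[OF q]] ln_ge_half[OF r] by simp
  have lnr: "ln (real r) > 0" and lnq: "ln (real q) > 0" using ln_ge_half[OF r] ln_ge_half[OF q] by auto
  have lp: "l \<le> real p - 1" unfolding l_def using p3 ln_le_minus_one[of "real p"] by simp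
  have "0 < 283 * (real p - 1) * E" using E p3 by (intro mult_pos_pos) auto
  hence "0 < (real v - 4) * l\<^sup>2" using main by linarith
  hence v4: "real v > 4" using l by (simp add: zero_less_mult_iff)
  hence v0: "v > 0" by simp
  have copq: "coprime p q" using p pq by (simp add: prime_imp_coprime_nat)
  have d0: "d > 0" using copq by (simp add: d_def)
  have qd: "q ^ d > 1" using q d0 by (metis one_less_power Suc_1 Suc_le_lessD)
  have ln_pred: "ln (real (n - 1)) \<le> ln (real n)" if "n > 1" for n :: nat
    using that by (subst ln_le_cancel_iff) auto
  define V where "V = real v * l"
  have "V \<le> ln (real (q ^ d - 1))"
    unfolding V_def v_def l_def using p3 qd by (intro multiplicity_times_ln_le) auto
  \<comment> \<open>The trivial bound \<open>p ^ v < q ^ d\<close> matters: it makes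
    \<open>d\<close> large enough for the box side \<open>S\<close> not to exceed the order.\<close>
  also have "\<dots> \<le> ln (real (q ^ d))" using qd by (rule ln_pred)
  also have "\<dots> = real d * ln (real q)" using q by (simp add: ln_realpow)
  finally have Vd: "V \<le> real d * ln (real q)" .
  have "4 * 1 < V" unfolding V_def using v4 l by (intro mult_less_le_imp_less) auto
  hence V4: "V > 4" by simp
  define W where "W = V - ln 32"
  have W: "W > 0" "W \<le> V" using V4 ln_32_le by (auto simp: W_def)
  \<comment> \<open>The two powers in the box inequality receive equal shares:
    \<open>8 * ln r * \<alpha>\<close> and \<open>2 * ln q * \<beta>\<close> are both
    \<open>W / 2\<close>. Rounding up is harmless, as only \<open>R - 1\<close> and
    \<open>S - 1\<close> occur in the exponents.\<close>
  define \<alpha> where "\<alpha> = W / (16 * ln (real r))"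
  define \<beta> where "\<beta> = W / (4 * ln (real q))"
  have ab: "\<alpha> > 0" "\<beta> > 0" using W lnr lnq by (auto simp: \<alpha>_def \<beta>_def)
  define R where "R = nat \<lceil>\<alpha>\<rceil>"
  define S where "S = nat \<lceil>\<beta>\<rceil>"
  have R: "\<alpha> \<le> real R" "real (R - 1) \<le> \<alpha>" using ab(1) unfolding R_def by linarith+
  have S: "\<beta> \<le> real S" "real (S - 1) \<le> \<beta>" using ab(2) unfolding S_def by linarith+
  have "\<beta> \<le> real d"
  proof -
    have "W \<le> real d * ln (real q) * 4" using W Vd by linarith
    thus ?thesis using lnq by (simp add: \<beta>_def pos_divide_le_eq mult_ac)
  qed
  hence Sd: "S \<le> ord p q" unfolding S_def d_def[symmetric] by linarith
  have "[q ^ d = 1] (mod p ^ v)"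
    using qd by (subst cong_altdef_nat) (auto simp: v_def multiplicity_dvd)
  moreover have "d dvd p - 1" unfolding d_def
    using order_divides_totient[OF copq] p by (simp add: totient_prime)
  ultimately have qv: "[q ^ (p - 1) = 1] (mod p ^ v)"
    by (metis cong_pow dvdE power_mult power_one)
  have "3 * real v * (real p - 1) \<le> \<alpha> * \<beta>"
  proof -
    \<comment> \<open>The product \<open>\<alpha> * \<beta>\<close> equals
      \<open>W\<^sup>2 / (64 * E)\<close>, so \<open>3 * v * (p - 1)\<close> points require
      \<open>192 = 3 * 64\<close>. The remaining \<open>91 = 283 - 192\<close> absorbs the loss
      \<open>8 * l\<close>, which comes from \<open>ln 32\<close> in \<open>W\<close>.\<close>
    have "192 * (real p - 1) * E \<le> l * (V - 8)"
    proof -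
      have "8 * l \<le> 91 * (real p - 1) * (1 / 4)" using lp p3 by simp
      also have "\<dots> \<le> 91 * (real p - 1) * E" using E p3 by (intro mult_left_mono) auto
      finally have "192 * (real p - 1) * E + 8 * l \<le> 283 * (real p - 1) * E" by (simp add: algebra_simps)
      also have "\<dots> \<le> real v * l\<^sup>2" using main zero_le_power2[of l] unfolding left_diff_distrib by linarith
      also have "\<dots> = V * l" by (simp add: V_def power2_eq_square)
      finally show ?thesis by (simp add: algebra_simps)
    qed
    hence "real v * (192 * (real p - 1) * E) \<le> real v * (l * (V - 8))" by (rule mult_left_mono) simp
    also have "\<dots> = V * V - 8 * V" by (simp add: V_def algebra_simps)
    also have "\<dots> \<le> V * V - 2 * ln 32 * V"
      using ln_32_le V4 by (intro diff_left_mono mult_right_mono) auto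
    also have "\<dots> \<le> W * W" unfolding W_def by (simp add: algebra_simps)
    finally show ?thesis using lnr lnq unfolding \<alpha>_def \<beta>_def E_def
      by (simp add: pos_le_divide_eq) (simp add: algebra_simps)
  qed
  also have "\<dots> \<le> real R * real S" using R S ab by (intro mult_mono) auto
  also have "3 * real v * (real p - 1) = real (3 * v * (p - 1))" using p3 by (simp add: of_nat_diff)
  finally have "3 * v * (p - 1) \<le> R * S" by (simp only: of_nat_mult[symmetric] of_nat_le_iff)
  from modulus_less_of_box[OF p(1) r q cop pr pq v0 qv Sd this]
  have "real (p ^ v) < real (32 * r ^ (8 * (R - 1)) * q ^ (2 * (S - 1)))" by (simp only: of_nat_less_iff)
  hence "ln (real (p ^ v)) < ln (real (32 * r ^ (8 * (R - 1)) * q ^ (2 * (S - 1))))"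
    using p3 r q by (subst ln_less_cancel_iff) auto
  hence "V < ln 32 + real (R - 1) * (8 * ln (real r)) + real (S - 1) * (2 * ln (real q))"
    using p3 r q by (simp add: ln_mult ln_realpow V_def l_def mult_ac)
  also have "\<dots> \<le> ln 32 + \<alpha> * (8 * ln (real r)) + \<beta> * (2 * ln (real q))"
    using R S lnr lnq by (intro add_mono mult_right_mono) auto
  also have "\<dots> = V" using lnr lnq by (simp add: \<alpha>_def \<beta>_def W_def field_simps)
  finally show False by simp
qed

section \<open>Bounds for the valuation of the divisor sum\<close>

lemma multiplicity_sigma_bound:
  fixes p r q c :: nat
  assumes p: "prime p" "odd p" and r: "2 \<le> r" and q: "prime q" and cop: "coprime r q"
    and pr: "\<not> p dvd r"
  shows "int (multiplicity p (sigma (q ^ c))) \<le> int (multiplicity p (c + 1))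
    + \<lfloor>283 * (real p - 1) * (ln (real r) / ln (real p)) * (ln (real r * real q) / ln (real p))\<rfloor> + 4"
proof -
  define X where "X = 283 * (real p - 1) * (ln (real r) / ln (real p)) * (ln (real r * real q) / ln (real p))"
  have q2: "q \<ge> 2" using q by (rule prime_ge_2_nat)
  have p2: "p \<ge> 2" using p by (intro prime_ge_2_nat)
  have X0: "X \<ge> 0"
    unfolding X_def using p2 q2 r mult_mono[of 1 "real r" 1 "real q"]
    by (intro mult_nonneg_nonneg divide_nonneg_nonneg ln_ge_zero) auto
  show ?thesis
  proof (cases "p = q")
    case True
    thus ?thesis using multiplicity_sigma_self[OF p(1)] X0 by (simp add: X_def)
  next
    case False
    hence pq: "\<not> p dvd q" using p q primes_dvd_imp_eq by blast
    define v where "v = multiplicity p (q ^ ord p q - 1)"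
    have "multiplicity p (sigma (q ^ c)) \<le> multiplicity p (c + 1) + v"
      unfolding v_def sigma_prime_power[OF q]
      by (rule multiplicity_geometric_sum_le_ord) (use p pq q2 in auto)
    moreover have "real v \<le> 283 * (real p - 1) * ln (real r) * ln (real q) / (ln (real p))\<^sup>2 + 4"
      unfolding v_def by (rule multiplicity_ord_bound) (use assms q2 pq in auto)
    moreover have "283 * (real p - 1) * ln (real r) * ln (real q) / (ln (real p))\<^sup>2 \<le> X"
    proof -
      have "283 * (real p - 1) * ln (real r) * ln (real q) \<le> 283 * (real p - 1) * ln (real r) * ln (real r * real q)"
        using p2 q2 r by (intro mult_left_mono mult_nonneg_nonneg) (auto simp: ln_mult)
      hence "283 * (real p - 1) * ln (real r) * ln (real q) / (ln (real p))\<^sup>2 \<le> 283 * (real p - 1) * ln (real r) * ln (real r * real q) / (ln (real p))\<^sup>2"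
        by (rule divide_right_mono) auto
      thus ?thesis by (simp add: X_def power2_eq_square)
    qed
    \<comment> \<open>As \<open>v\<close> is an integer, the constant 4 can be moved out before
      taking the floor.\<close>
    ultimately have "int v - 4 \<le> \<lfloor>X\<rfloor>" by (simp add: le_floor_iff)
    with \<open>multiplicity p (sigma (q ^ c)) \<le> _\<close> show ?thesis by (simp add: X_def)
  qed
qed

text \<open>The power of 2 in \<open>q + 1\<close> is at most \<open>2 * q\<close>; the extra factor
  2 matches the 1 subtracted in the lifting lemma.\<close>

lemma multiplicity_2_sigma_le:
  fixes q c :: nat
  assumes "prime q" "odd q"
  shows "real (multiplicity 2 (sigma (q ^ c))) \<le> real (multiplicity 2 (c + 1)) + ln (real q) / ln 2"
proof -
  define w where "w = multiplicity 2 (q + 1)"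
  have q: "q > 0" using assms prime_gt_0_nat by blast
  have "w \<ge> 1" unfolding w_def using assms by (intro multiplicity_geI) auto
  moreover have "real w * ln 2 \<le> ln (2 * real q)"
  proof -
    have "real w * ln 2 \<le> ln (real (q + 1))" unfolding w_def using multiplicity_times_ln_le[of 2 "q + 1"] by simp
    also have "\<dots> \<le> ln (2 * real q)" using q by (subst ln_le_cancel_iff) auto
    finally show ?thesis .
  qed
  hence "(real w - 1) * ln 2 \<le> ln (real q)" using q by (simp add: ln_mult algebra_simps)
  hence "real w - 1 \<le> ln (real q) / ln 2" by (simp add: pos_le_divide_eq)
  moreover have "multiplicity 2 (sigma (q ^ c)) \<le> multiplicity 2 (c + 1) + (w - 1)"
    unfolding sigma_prime_power[OF assms(1)] w_def by (rule multiplicity_2_geometric_sum_le) (use assms in auto)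
  hence "real (multiplicity 2 (sigma (q ^ c))) \<le> real (multiplicity 2 (c + 1) + (w - 1))" by (simp only: of_nat_le_iff)
  ultimately show ?thesis by (simp add: of_nat_diff)
qed

text \<open>The auxiliary base is \<open>r = 2\<close>, which must be prime to \<open>p\<close>; for
  \<open>p = 2\<close> the elementary estimate by the binary logarithm of \<open>q\<close> is
  already smaller.\<close>

lemma multiplicity_sigma_bound_odd:
  fixes p q c :: nat
  assumes "prime p" "prime q" "odd q"
  shows "int (multiplicity p (sigma (q ^ c))) \<le> int (multiplicity p (c + 1))
    + \<lfloor>283 * (real p - 1) * (ln 2 / ln (real p)) * (ln (2 * real q) / ln (real p))\<rfloor> + 4"
proof (cases "p = 2")
  case False
  hence "odd p" using assms(1) primes_dvd_imp_eq two_is_prime_nat by blast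
  moreover have "\<not> p dvd 2" using assms(1) False primes_dvd_imp_eq two_is_prime_nat by blast
  ultimately show ?thesis using multiplicity_sigma_bound[of p 2 q c] assms by simp
next
  case True
  have q: "q \<ge> 2" using assms(2) by (rule prime_ge_2_nat)
  define X where "X = 283 * (ln (2 * real q) / ln 2)"
  have "ln (real q) / ln 2 \<le> ln (2 * real q) / ln 2" using q by (intro divide_right_mono) auto
  also have "\<dots> \<le> X" unfolding X_def using q by (simp add: divide_right_mono)
  finally have "real (multiplicity 2 (sigma (q ^ c))) - real (multiplicity 2 (c + 1)) \<le> X"
    using multiplicity_2_sigma_le[OF assms(2,3), of c] by linarith
  hence "int (multiplicity 2 (sigma (q ^ c))) - int (multiplicity 2 (c + 1)) \<le> \<lfloor>X\<rfloor>"
    by (simp add: le_floor_iff)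
  thus ?thesis by (simp add: True X_def)
qed

lemma multiplicity_sigma_bound_two:
  fixes p c :: nat
  assumes "prime p"
  shows "int (multiplicity p (sigma (2 ^ c))) \<le> int (multiplicity p (c + 1))
    + \<lfloor>283 * (real p - 1) * (ln 3 / ln (real p)) * (ln 6 / ln (real p))\<rfloor> + 4"
proof -
  consider "p = 2" | "p = 3" | "p \<noteq> 2" "p \<noteq> 3" by blast
  thus ?thesis
  proof cases
    case 1
    thus ?thesis using multiplicity_sigma_self[of 2 c] by simp
  next
    case 2
    have "multiplicity 3 ((2 :: nat) ^ ord (3 :: nat) 2 - 1) \<le> 1"
    proof -
      have "ord 3 (2 :: nat) dvd 2" by (subst ord_divides[symmetric]) (simp add: cong_def)
      hence "ord 3 (2 :: nat) \<le> 2" by (rule dvd_imp_le) simp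
      moreover have "ord 3 (2 :: nat) \<noteq> 0" by (simp add: ord_eq_0)
      ultimately have "ord 3 (2 :: nat) = 1 \<or> ord 3 (2 :: nat) = 2" by linarith
      thus ?thesis by auto
    qed
    hence "multiplicity 3 (sigma (2 ^ c)) \<le> multiplicity 3 (c + 1) + 1"
      unfolding sigma_prime_power[OF two_is_prime_nat]
      using multiplicity_geometric_sum_le_ord[of 3 2 "c + 1"] by (simp del: sum.lessThan_Suc)
    moreover have "0 \<le> \<lfloor>283 * (real p - 1) * (ln 3 / ln (real p)) * (ln 6 / ln (real p))\<rfloor>"
      using 2 by simp
    ultimately show ?thesis unfolding 2 by linarith
  next
    case 3
    hence "odd p" using assms(1) primes_dvd_imp_eq two_is_prime_nat by blast
    moreover have "prime (3 :: nat)" by simp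
    hence "\<not> p dvd 3" using assms(1) 3 primes_dvd_imp_eq by blast
    moreover have "coprime 3 (2 :: nat)" by simp
    ultimately show ?thesis using multiplicity_sigma_bound[of p 3 2 c] assms by simp
  qed
qed

text \<open>The order of \<open>q\<close> divides \<open>p - 1\<close>, so the valuation left by
  lifting the exponent is at most that of \<open>q ^ (p - 1) - 1\<close>. The cases
  \<open>p = 2\<close> and \<open>p = q\<close> are settled directly and create no further
  exceptions.\<close>

lemma multiplicity_sigma_bound_of_fermat_quotient:
  fixes p q c :: nat
  assumes p: "prime p" and q: "prime q" "odd q"
    and H: "real (multiplicity (int p) (int q ^ (p - 1) - 1))
      \<le> 2 + (ln (real q) + ln (ln (real q)) + ln (ln (real p))) / ln (real p)"
  shows "real (multiplicity p (sigma (q ^ c))) \<le> real (multiplicity p (c + 1)) + 2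
      + (ln (real q) + ln (ln (real q)) + ln (ln (real p))) / ln (real p)"
proof -
  have q3: "q \<ge> 3" using q prime_ge_2_nat[of q] by (cases "q = 2") auto
  have lnq: "ln (real q) \<ge> 1" by (rule one_le_ln[OF q3])
  hence llq: "ln (ln (real q)) \<ge> 0" by simp
  consider "p = 2" | "p = q" | "p \<noteq> 2" "p \<noteq> q" by blast
  thus ?thesis
  proof cases
    case 1
    \<comment> \<open>For \<open>p = 2\<close> the relevant number is \<open>q + 1\<close>, whereas
      the assumed bound concerns \<open>q - 1\<close>. The elementary bound suffices because
      \<open>2 * ln 2\<close> compensates the negative \<open>ln (ln 2)\<close>.\<close>
    have "1 / 2 \<le> ln (2 :: real)" using ln_ge_half[of 2] by simp
    moreover have "- 1 \<le> ln (ln (2 :: real))"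
    proof -
      have "inverse (ln 2) \<le> (2 :: real)" using \<open>1 / 2 \<le> ln (2 :: real)\<close> by (simp add: field_simps)
      hence "ln (inverse (ln 2)) \<le> ln (2 :: real)" by (subst ln_le_cancel_iff) auto
      thus ?thesis using ln_2_less_1 by (simp add: ln_inverse)
    qed
    ultimately have "0 \<le> 2 * ln 2 + (ln (ln (real q)) + ln (ln 2))" using llq by linarith
    hence "0 \<le> (2 * ln 2 + (ln (ln (real q)) + ln (ln 2))) / ln 2" by (intro divide_nonneg_nonneg) auto
    hence "ln (real q) / ln 2 \<le> 2 + (ln (real q) + ln (ln (real q)) + ln (ln 2)) / ln 2"
      by (simp add: add_divide_distrib)
    thus ?thesis using multiplicity_2_sigma_le[OF q, of c] 1 by simp
  next
    case 2
    have "0 \<le> (ln (real q) + ln (ln (real q)) + ln (ln (real q))) / ln (real q)"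
      using lnq llq by (intro divide_nonneg_nonneg) auto
    thus ?thesis using 2 multiplicity_sigma_self[OF q(1)] by simp
  next
    case 3
    have podd: "odd p" using p 3(1) primes_dvd_imp_eq two_is_prime_nat by blast
    have pq: "\<not> p dvd q" using p q 3(2) primes_dvd_imp_eq by blast
    define v where "v = multiplicity p (q ^ ord p q - 1)"
    have copq: "coprime p q" using p pq by (simp add: prime_imp_coprime_nat)
    have p1: "p > 1" using p by (rule prime_gt_1_nat)
    have "v \<le> multiplicity (int p) (int q ^ (p - 1) - 1)"
    proof (rule multiplicity_geI)
      have "q ^ ord p q \<ge> 1" using q3 by simp
      hence "[q ^ ord p q = 1] (mod p ^ v)"
        by (subst cong_altdef_nat) (auto simp: v_def multiplicity_dvd)
      moreover have "ord p q dvd p - 1"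
        using order_divides_totient[OF copq] p by (simp add: totient_prime)
      ultimately have "[q ^ (p - 1) = 1] (mod p ^ v)"
        by (metis cong_pow dvdE power_mult power_one)
      hence "[int (q ^ (p - 1)) = int 1] (mod int (p ^ v))" by (simp only: cong_int_iff)
      thus "int p ^ v dvd int q ^ (p - 1) - 1" by (simp add: cong_iff_dvd_diff)
      have "int q ^ (p - 1) > 1" using q3 p1 by (intro one_less_power) auto
      thus "int q ^ (p - 1) - 1 \<noteq> 0" by simp
      show "\<not> is_unit (int p)" using p1 by simp
    qed
    moreover have "multiplicity p (sigma (q ^ c)) \<le> multiplicity p (c + 1) + v"
      unfolding v_def sigma_prime_power[OF q(1)]
      by (rule multiplicity_geometric_sum_le_ord) (use p podd pq q3 in auto)
    ultimately show ?thesis using H by linarith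
  qed
qed

theorem theorem3:
  shows "(\<forall>p q c :: nat. prime p \<longrightarrow> prime q \<longrightarrow> odd q \<longrightarrow> c > 0 \<longrightarrow>
           int (multiplicity p (sigma (q ^ c)))
             \<le> int (multiplicity p (c + 1))
               + \<lfloor>283 * (real p - 1) * (ln 2 / ln (real p)) * (ln (2 * real q) / ln (real p))\<rfloor> + 4)
       \<and> (\<forall>p c :: nat. prime p \<longrightarrow> c > 0 \<longrightarrow>
           int (multiplicity p (sigma (2 ^ c)))
             \<le> int (multiplicity p (c + 1))
               + \<lfloor>283 * (real p - 1) * (ln 3 / ln (real p)) * (ln 6 / ln (real p))\<rfloor> + 4)
       \<and> (hypothesis_H \<longrightarrow>
           finite {(p :: nat, q :: nat). prime p \<and> prime q \<and> odd q \<and>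
             \<not> (\<forall>c :: nat. c > 0 \<longrightarrow>
                  real (multiplicity p (sigma (q ^ c)))
                    \<le> real (multiplicity p (c + 1)) + 2
                      + (ln (real q) + ln (ln (real q)) + ln (ln (real p))) / ln (real p))})"
proof (intro conjI allI impI)
  assume hypothesis_H
  let ?bound = "\<lambda>p q c :: nat. real (multiplicity p (sigma (q ^ c)))
    \<le> real (multiplicity p (c + 1)) + 2 + (ln (real q) + ln (ln (real q)) + ln (ln (real p))) / ln (real p)"
  \<comment> \<open>\<open>E\<close> is the exceptional set of (H)(ii), with \<open>q\<close> first;
    exchanging the coordinates covers every exceptional pair of the conclusion.\<close>
  define E where "E = {(q :: nat, p :: nat). prime q \<and> prime p \<and>
       \<not> real (multiplicity (int p) (int q ^ (p - 1) - 1))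
           \<le> 2 + (ln (real q) + ln (ln (real q)) + ln (ln (real p))) / ln (real p)}"
  have "(q, p) \<in> E" if "prime p" "prime q" "odd q" "\<not> ?bound p q c" for p q c :: nat
    using multiplicity_sigma_bound_of_fermat_quotient[OF that(1-3), of c] that by (auto simp: E_def)
  hence "{(p, q). prime p \<and> prime q \<and> odd q \<and> \<not> (\<forall>c. c > 0 \<longrightarrow> ?bound p q c)} \<subseteq> prod.swap ` E"
    by auto
  moreover have "finite (prod.swap ` E)"
    using \<open>hypothesis_H\<close> by (simp add: hypothesis_H_def E_def)
  ultimately show "finite {(p, q). prime p \<and> prime q \<and> odd q \<and> \<not> (\<forall>c. c > 0 \<longrightarrow> ?bound p q c)}"
    by (rule finite_subset)
qed (erule (2) multiplicity_sigma_bound_odd, erule multiplicity_sigma_bound_two)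

end
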